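(* Let $(V,\bullet,[-,-])$ be a transposed Poisson algebra over $\mathbb{K}$ and let $\mu(x,y)=xy=\frac12(x\bullet y+[x,y])$ be the depolarization of the couple $(\bullet,[-,-])$. Then $\mu$ satisfies, for all $x_1,x_2,x_3\in V$, the following three axioms: (T) $\;2(x_1x_2)x_3-2(x_2x_1)x_3+(x_3x_2)x_1-(x_1x_3)x_2+(x_2x_3)x_1-(x_3x_1)x_2-x_1(x_2x_3)+x_2(x_1x_3)-2x_3(x_2x_1)-x_1(x_3x_2)+x_2(x_3x_1)+2x_3(x_1x_2)=0,$ (J) $\;(x_1x_2)x_3-(x_2x_1)x_3-(x_3x_2)x_1-(x_1x_3)x_2+(x_2x_3)x_1+(x_3x_1)x_2-x_1(x_2x_3)+x_2(x_1x_3)+x_3(x_2x_1)+x_1(x_3x_2)-x_2(x_3x_1)-x_3(x_1x_2)=0,$ (A) $\;(x_1x_2)x_3+(x_2x_1)x_3-(x_3x_2)x_1-(x_2x_3)x_1-x_1(x_2x_3)+x_3(x_2x_1)-x_1(x_3x_2)+x_3(x_1x_2)=0.$ Moreover these axioms are independent: none of the three can be deduced from another one of them by taking linear combinations of the images of that other axiom under the action of $\Sigma_3$.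
   Context: $\mathbb{K}$ is an algebraically closed field of characteristic $0$ and $V$ is a $\mathbb{K}$-vector space. A transposed Poisson algebra is a triple $(V,\bullet,[-,-])$ where $\bullet$ and $[-,-]$ are bilinear operations on $V$ such that $(V,\bullet)$ is a commutative associative algebra, $(V,[-,-])$ is a Lie algebra, and $2z\bullet[x,y]=[z\bullet x,y]+[x,z\bullet y]$ for all $x,y,z\in V$. An axiom is regarded as a formal $\mathbb{K}$-linear combination of the twelve monomials $(x_ix_j)x_k$ and $x_i(x_jx_k)$, $\{i,j,k\}=\{1,2,3\}$ (elements of a $12$-dimensional space); a permutation $\sigma\in\Sigma_3$ acts by $(x_ix_j)x_k\mapsto (x_{\sigma(i)}x_{\sigma(j)})x_{\sigma(k)}$ and $x_i(x_jx_k)\mapsto x_{\sigma(i)}(x_{\sigma(j)}x_{\sigma(k)})$, extended linearly. *)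

theory Defs
  imports
    "HOL-Computational_Algebra.Polynomial"
    "HOL-Library.Poly_Mapping"
    "HOL-Combinatorics.Permutations"
begin

definition bilinear_op :: "('k::field \<Rightarrow> 'v::ab_group_add \<Rightarrow> 'v) \<Rightarrow> ('v \<Rightarrow> 'v \<Rightarrow> 'v) \<Rightarrow> bool" where
  "bilinear_op scale f \<longleftrightarrow>
     (\<forall>x. Vector_Spaces.linear scale scale (\<lambda>y. f x y)) \<and>
     (\<forall>y. Vector_Spaces.linear scale scale (\<lambda>x. f x y))"

locale commutative_associative_algebra = vector_space scale
  for scale :: "'k::field \<Rightarrow> 'v::ab_group_add \<Rightarrow> 'v" +
  fixes bullet :: "'v \<Rightarrow> 'v \<Rightarrow> 'v"
  assumes bullet_bilinear: "bilinear_op scale bullet"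
    and bullet_commute: "bullet x y = bullet y x"
    and bullet_assoc: "bullet (bullet x y) z = bullet x (bullet y z)"

locale lie_algebra = vector_space scale
  for scale :: "'k::field \<Rightarrow> 'v::ab_group_add \<Rightarrow> 'v" +
  fixes bracket :: "'v \<Rightarrow> 'v \<Rightarrow> 'v"
  assumes bracket_bilinear: "bilinear_op scale bracket"
    and bracket_self: "bracket x x = 0"
    and jacobi: "bracket (bracket x y) z + bracket (bracket y z) x + bracket (bracket z x) y = 0"

locale transposed_poisson_algebra =
  commutative_associative_algebra scale bullet + lie_algebra scale bracket
  for scale :: "'k::field \<Rightarrow> 'v::ab_group_add \<Rightarrow> 'v"
    and bullet :: "'v \<Rightarrow> 'v \<Rightarrow> 'v" and bracket :: "'v \<Rightarrow> 'v \<Rightarrow> 'v" +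
  assumes transposed_leibniz:
    "scale 2 (bullet z (bracket x y)) = bracket (bullet z x) y + bracket x (bullet z y)"

definition depolarization ::
  "('k::field \<Rightarrow> 'v::ab_group_add \<Rightarrow> 'v) \<Rightarrow> ('v \<Rightarrow> 'v \<Rightarrow> 'v) \<Rightarrow> ('v \<Rightarrow> 'v \<Rightarrow> 'v) \<Rightarrow> 'v \<Rightarrow> 'v \<Rightarrow> 'v" where
  "depolarization scale bullet bracket x y = scale (1 / 2) (bullet x y + bracket x y)"

datatype 'i magma_word = Var 'i | Prod "'i magma_word" "'i magma_word"

abbreviation lmonomial :: "'i \<Rightarrow> 'i \<Rightarrow> 'i \<Rightarrow> 'i magma_word" where
  "lmonomial i j k \<equiv> Prod (Prod (Var i) (Var j)) (Var k)"

abbreviation rmonomial :: "'i \<Rightarrow> 'i \<Rightarrow> 'i \<Rightarrow> 'i magma_word" where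
  "rmonomial i j k \<equiv> Prod (Var i) (Prod (Var j) (Var k))"

text \<open>
  An axiom is a finitely supported function from words to scalars whose support lies among
  the twelve words in \<open>monomials3\<close>. Working in the larger space of all words is harmless:
  \<open>axiom_space\<close> is a subspace, stable under permutations of the three variables.
\<close>

definition monomials3 :: "nat magma_word set" where
  "monomials3 = {lmonomial i j k | i j k. {i, j, k} = {1, 2, 3}} \<union>
                {rmonomial i j k | i j k. {i, j, k} = {1, 2, 3}}"

definition axiom_space :: "(nat magma_word \<Rightarrow>\<^sub>0 'k::field) set" where
  "axiom_space = {a. Poly_Mapping.keys a \<subseteq> monomials3}"

definition comb_scale :: "'k::field \<Rightarrow> ('b \<Rightarrow>\<^sub>0 'k) \<Rightarrow> ('b \<Rightarrow>\<^sub>0 'k)"  (infixr "*\<^sub>c" 75) where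
  "c *\<^sub>c a = Poly_Mapping.map ((*) c) a"

lemma lookup_comb_scale: "Poly_Mapping.lookup (c *\<^sub>c a) m = c * Poly_Mapping.lookup a m"
  by (simp add: comb_scale_def Poly_Mapping.map.rep_eq when_def)

interpretation comb: vector_space comb_scale
  by unfold_locales
    (auto intro!: poly_mapping_eqI simp: lookup_comb_scale lookup_add algebra_simps)

definition permute_axiom ::
  "(nat \<Rightarrow> nat) \<Rightarrow> (nat magma_word \<Rightarrow>\<^sub>0 'k::field) \<Rightarrow> (nat magma_word \<Rightarrow>\<^sub>0 'k)" where
  "permute_axiom \<sigma> a =
     (\<Sum>m\<in>Poly_Mapping.keys a. Poly_Mapping.single (map_magma_word \<sigma> m) (Poly_Mapping.lookup a m))"

definition deducible_from ::
  "(nat magma_word \<Rightarrow>\<^sub>0 'k::field) \<Rightarrow> (nat magma_word \<Rightarrow>\<^sub>0 'k) \<Rightarrow> bool" where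
  "deducible_from b a \<longleftrightarrow> b \<in> comb.span {permute_axiom \<sigma> a | \<sigma>. \<sigma> permutes {1, 2, 3}}"

primrec eval_word :: "('v \<Rightarrow> 'v \<Rightarrow> 'v) \<Rightarrow> ('i \<Rightarrow> 'v) \<Rightarrow> 'i magma_word \<Rightarrow> 'v" where
  "eval_word \<mu> x (Var i) = x i"
| "eval_word \<mu> x (Prod s t) = \<mu> (eval_word \<mu> x s) (eval_word \<mu> x t)"

definition eval_axiom :: "('k::field \<Rightarrow> 'v::ab_group_add \<Rightarrow> 'v) \<Rightarrow> ('v \<Rightarrow> 'v \<Rightarrow> 'v) \<Rightarrow>
    (nat \<Rightarrow> 'v) \<Rightarrow> (nat magma_word \<Rightarrow>\<^sub>0 'k) \<Rightarrow> 'v" where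
  "eval_axiom scale \<mu> x a =
     (\<Sum>m\<in>Poly_Mapping.keys a. scale (Poly_Mapping.lookup a m) (eval_word \<mu> x m))"

definition satisfies_axiom :: "('k::field \<Rightarrow> 'v::ab_group_add \<Rightarrow> 'v) \<Rightarrow> ('v \<Rightarrow> 'v \<Rightarrow> 'v) \<Rightarrow>
    (nat magma_word \<Rightarrow>\<^sub>0 'k) \<Rightarrow> bool" where
  "satisfies_axiom scale \<mu> a \<longleftrightarrow> (\<forall>x. eval_axiom scale \<mu> x a = 0)"

abbreviation lm :: "nat \<Rightarrow> nat \<Rightarrow> nat \<Rightarrow> (nat magma_word \<Rightarrow>\<^sub>0 'k::field)" where
  "lm i j k \<equiv> Poly_Mapping.single (lmonomial i j k) 1"

abbreviation rm :: "nat \<Rightarrow> nat \<Rightarrow> nat \<Rightarrow> (nat magma_word \<Rightarrow>\<^sub>0 'k::field)" where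
  "rm i j k \<equiv> Poly_Mapping.single (rmonomial i j k) 1"

definition axiom_T :: "nat magma_word \<Rightarrow>\<^sub>0 'k::field" where
  "axiom_T =
     2 *\<^sub>c lm 1 2 3 - 2 *\<^sub>c lm 2 1 3 + lm 3 2 1 - lm 1 3 2 + lm 2 3 1 - lm 3 1 2
     - rm 1 2 3 + rm 2 1 3 - 2 *\<^sub>c rm 3 2 1 - rm 1 3 2 + rm 2 3 1 + 2 *\<^sub>c rm 3 1 2"

definition axiom_J :: "nat magma_word \<Rightarrow>\<^sub>0 'k::field" where
  "axiom_J =
     lm 1 2 3 - lm 2 1 3 - lm 3 2 1 - lm 1 3 2 + lm 2 3 1 + lm 3 1 2
     - rm 1 2 3 + rm 2 1 3 + rm 3 2 1 + rm 1 3 2 - rm 2 3 1 - rm 3 1 2"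

definition axiom_A :: "nat magma_word \<Rightarrow>\<^sub>0 'k::field" where
  "axiom_A =
     lm 1 2 3 + lm 2 1 3 - lm 3 2 1 - lm 2 3 1
     - rm 1 2 3 + rm 3 2 1 - rm 1 3 2 + rm 3 1 2"

lemma set3_eq_iff:
  "{i, j, k} = {1, 2, 3::nat} \<longleftrightarrow>
     (i, j, k) \<in> {(1, 2, 3), (1, 3, 2), (2, 1, 3), (2, 3, 1), (3, 1, 2), (3, 2, 1)}"
proof
  assume eq: "{i, j, k} = {1, 2, 3}"
  then have "i \<in> {1, 2, 3}" "j \<in> {1, 2, 3}" "k \<in> {1, 2, 3}"
    by blast+
  with eq show "(i, j, k) \<in> {(1, 2, 3), (1, 3, 2), (2, 1, 3), (2, 3, 1), (3, 1, 2), (3, 2, 1)}"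
    by (elim insertE emptyE) (simp_all add: set_eq_iff, presburger+)
qed auto

lemma monomials3_eq:
  "monomials3 =
     {lmonomial 1 2 3, lmonomial 1 3 2, lmonomial 2 1 3, lmonomial 2 3 1, lmonomial 3 1 2, lmonomial 3 2 1,
      rmonomial 1 2 3, rmonomial 1 3 2, rmonomial 2 1 3, rmonomial 2 3 1, rmonomial 3 1 2, rmonomial 3 2 1}"
  unfolding monomials3_def set3_eq_iff by auto

lemma card_monomials3: "card monomials3 = 12"
  unfolding monomials3_eq by simp

lemma subspace_axiom_space: "comb.subspace axiom_space"
  unfolding comb.subspace_def axiom_space_def
  by (auto simp: subset_iff in_keys_iff lookup_add lookup_comb_scale) (metis add.right_neutral)

lemma permute_axiom_in_axiom_space:
  assumes "a \<in> axiom_space" "\<sigma> permutes {1, 2, 3}"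
  shows "permute_axiom \<sigma> a \<in> axiom_space"
  unfolding permute_axiom_def
proof (rule comb.subspace_sum[OF subspace_axiom_space])
  fix m assume "m \<in> Poly_Mapping.keys a"
  then have "m \<in> monomials3"
    using assms(1) by (auto simp: axiom_space_def)
  moreover have "{i, j, k} = {1, 2, 3} \<Longrightarrow> {\<sigma> i, \<sigma> j, \<sigma> k} = {1, 2, 3}" for i j k
    using permutes_image[OF assms(2)] by (metis image_insert image_empty)
  ultimately have "map_magma_word \<sigma> m \<in> monomials3"
    unfolding monomials3_def by auto
  then show "Poly_Mapping.single (map_magma_word \<sigma> m) (Poly_Mapping.lookup a m) \<in> axiom_space"
    by (auto simp: axiom_space_def)
qed

lemma axioms_in_axiom_space:
  "axiom_T \<in> axiom_space" "axiom_J \<in> axiom_space" "axiom_A \<in> axiom_space"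
proof -
  have "lm i j k \<in> axiom_space" "rm i j k \<in> axiom_space" if "{i, j, k} = {1, 2, 3}" for i j k
    using that by (auto simp: axiom_space_def monomials3_def)
  note mem = this[unfolded set3_eq_iff]
  show "axiom_T \<in> axiom_space" "axiom_J \<in> axiom_space" "axiom_A \<in> axiom_space"
    unfolding axiom_T_def axiom_J_def axiom_A_def
    by (intro comb.subspace_add comb.subspace_diff comb.subspace_scale subspace_axiom_space mem; simp)+
qed

context vector_space
begin

lemma eval_axiom_superset:
  assumes "finite S" "Poly_Mapping.keys a \<subseteq> S"
  shows "eval_axiom scale \<mu> x a = (\<Sum>m\<in>S. scale (Poly_Mapping.lookup a m) (eval_word \<mu> x m))"
  unfolding eval_axiom_def using assms
  by (intro sum.mono_neutral_left) (auto simp: in_keys_iff)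

lemma eval_axiom_add: "eval_axiom scale \<mu> x (a + b) = eval_axiom scale \<mu> x a + eval_axiom scale \<mu> x b"
proof -
  let ?S = "Poly_Mapping.keys a \<union> Poly_Mapping.keys b"
  have "finite ?S" by simp
  then show ?thesis
    using Poly_Mapping.keys_add[of a b]
    by (simp add: eval_axiom_superset[of ?S] lookup_add scale_left_distrib sum.distrib)
qed

lemma eval_axiom_scale: "eval_axiom scale \<mu> x (c *\<^sub>c a) = scale c (eval_axiom scale \<mu> x a)"
proof -
  have "Poly_Mapping.keys (c *\<^sub>c a) \<subseteq> Poly_Mapping.keys a"
    by (auto simp: in_keys_iff lookup_comb_scale)
  then show ?thesis
    by (simp add: eval_axiom_superset[of "Poly_Mapping.keys a"] lookup_comb_scale scale_sum_right)
qed

lemma eval_axiom_diff: "eval_axiom scale \<mu> x (a - b) = eval_axiom scale \<mu> x a - eval_axiom scale \<mu> x b"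
  using eval_axiom_add[of \<mu> x "a - b" b] by simp

lemma eval_axiom_single: "eval_axiom scale \<mu> x (Poly_Mapping.single m c) = scale c (eval_word \<mu> x m)"
  by (simp add: eval_axiom_def)

lemmas eval_axiom_simps = eval_axiom_add eval_axiom_diff eval_axiom_scale eval_axiom_single

lemma all_assignment3: "(\<forall>x::nat \<Rightarrow> 'b. P (x 1) (x 2) (x 3)) \<longleftrightarrow> (\<forall>x1 x2 x3. P x1 x2 x3)"
proof
  assume P: "\<forall>x::nat \<Rightarrow> 'b. P (x 1) (x 2) (x 3)"
  show "\<forall>x1 x2 x3. P x1 x2 x3"
  proof (intro allI)
    fix x1 x2 x3
    show "P x1 x2 x3"
      using P[rule_format, of "\<lambda>i. if i = 1 then x1 else if i = 2 then x2 else x3"] by simp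
  qed
qed simp

lemma satisfies_axiom_T_iff:
  fixes \<mu> :: "'b \<Rightarrow> 'b \<Rightarrow> 'b" (infixl "\<star>" 70)
  shows "satisfies_axiom scale \<mu> axiom_T \<longleftrightarrow> (\<forall>x1 x2 x3.
    scale 2 ((x1 \<star> x2) \<star> x3) - scale 2 ((x2 \<star> x1) \<star> x3) + (x3 \<star> x2) \<star> x1 - (x1 \<star> x3) \<star> x2
    + (x2 \<star> x3) \<star> x1 - (x3 \<star> x1) \<star> x2 - x1 \<star> (x2 \<star> x3) + x2 \<star> (x1 \<star> x3)
    - scale 2 (x3 \<star> (x2 \<star> x1)) - x1 \<star> (x3 \<star> x2) + x2 \<star> (x3 \<star> x1) + scale 2 (x3 \<star> (x1 \<star> x2)) = 0)"
  unfolding satisfies_axiom_def axiom_T_def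
  by (subst all_assignment3[symmetric]) (simp add: eval_axiom_simps)

lemma satisfies_axiom_J_iff:
  fixes \<mu> :: "'b \<Rightarrow> 'b \<Rightarrow> 'b" (infixl "\<star>" 70)
  shows "satisfies_axiom scale \<mu> axiom_J \<longleftrightarrow> (\<forall>x1 x2 x3.
    (x1 \<star> x2) \<star> x3 - (x2 \<star> x1) \<star> x3 - (x3 \<star> x2) \<star> x1 - (x1 \<star> x3) \<star> x2
    + (x2 \<star> x3) \<star> x1 + (x3 \<star> x1) \<star> x2 - x1 \<star> (x2 \<star> x3) + x2 \<star> (x1 \<star> x3)
    + x3 \<star> (x2 \<star> x1) + x1 \<star> (x3 \<star> x2) - x2 \<star> (x3 \<star> x1) - x3 \<star> (x1 \<star> x2) = 0)"
  unfolding satisfies_axiom_def axiom_J_def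
  by (subst all_assignment3[symmetric]) (simp add: eval_axiom_simps)

lemma satisfies_axiom_A_iff:
  fixes \<mu> :: "'b \<Rightarrow> 'b \<Rightarrow> 'b" (infixl "\<star>" 70)
  shows "satisfies_axiom scale \<mu> axiom_A \<longleftrightarrow> (\<forall>x1 x2 x3.
    (x1 \<star> x2) \<star> x3 + (x2 \<star> x1) \<star> x3 - (x3 \<star> x2) \<star> x1 - (x2 \<star> x3) \<star> x1
    - x1 \<star> (x2 \<star> x3) + x3 \<star> (x2 \<star> x1) - x1 \<star> (x3 \<star> x2) + x3 \<star> (x1 \<star> x2) = 0)"
  unfolding satisfies_axiom_def axiom_A_def
  by (subst all_assignment3[symmetric]) (simp add: eval_axiom_simps)

end

end

theory Submission
  imports Defs
begin

text \<open>
  That the axioms hold is seen by splitting the product \<open>\<mu>\<close> into its symmetric and skew parts: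
  \<open>T\<close> becomes the transposed Leibniz rule, \<open>J\<close> the Jacobi identity and \<open>A\<close> associativity of \<open>\<bullet>\<close>.
  For independence, each non-deducibility is witnessed by a linear functional on the space of
  axioms that vanishes on the whole \<open>\<Sigma>\<^sub>3\<close>-orbit of one axiom but not on the other one.
\<close>

lemma bilinear_opD:
  assumes "bilinear_op scale f"
  shows "f (x + y) z = f x z + f y z" "f x (y + z) = f x y + f x z"
    "f (scale c x) y = scale c (f x y)" "f x (scale c y) = scale c (f x y)"
  using assms unfolding bilinear_op_def
  by (auto simp: linear_iff_module_hom module_hom_iff)

context transposed_poisson_algebra
begin

lemma bracket_anticommute: "bracket x y = - bracket y x"
proof -
  have "bracket x y + bracket y x = bracket (x + y) (x + y)"
    unfolding bilinear_opD(1,2)[OF bracket_bilinear] by (simp add: bracket_self)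
  then show ?thesis
    by (simp add: bracket_self eq_neg_iff_add_eq_0)
qed

lemma scale_numeral_2: "scale 2 x = x + x"
  using scale_left_distrib[of 1 1 x] by simp

lemma depolarization_left_nested:
  "depolarization scale bullet bracket (depolarization scale bullet bracket x y) z =
     scale (1 / 4) (bullet (bullet x y) z + bullet (bracket x y) z
       + bracket (bullet x y) z + bracket (bracket x y) z)"
  unfolding depolarization_def
  by (simp add: bilinear_opD[OF bracket_bilinear] bilinear_opD[OF bullet_bilinear]
      scale_right_distrib ac_simps)

lemma depolarization_right_nested:
  "depolarization scale bullet bracket x (depolarization scale bullet bracket y z) =
     scale (1 / 4) (bullet x (bullet y z) + bullet x (bracket y z)
       + bracket x (bullet y z) + bracket x (bracket y z))"
  unfolding depolarization_def
  by (simp add: bilinear_opD[OF bracket_bilinear] bilinear_opD[OF bullet_bilinear]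
      scale_right_distrib ac_simps)

lemma bullet_left_commute: "bullet x (bullet y z) = bullet y (bullet x z)"
  by (metis bullet_assoc bullet_commute)

lemmas bullet_ac = bullet_assoc bullet_commute bullet_left_commute

lemma minus_left: "bracket (- x) y = - bracket x y" "bullet (- x) y = - bullet x y"
  using bracket_bilinear bullet_bilinear
  by (metis bilinear_opD(3) scale_minus_left scale_one)+

lemma minus_right: "bracket x (- y) = - bracket x y" "bullet x (- y) = - bullet x y"
  using bracket_bilinear bullet_bilinear
  by (metis bilinear_opD(4) scale_minus_left scale_one)+

text \<open>Turns an outer bracket so that its compound factor stands on the left; rewriting stops
  because in the axioms the other factor is a variable.\<close>

lemma bracket_swap_nested:
  "bracket x (bullet y z) = - bracket (bullet y z) x"
  "bracket x (bracket y z) = - bracket (bracket y z) x"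
  by (rule bracket_anticommute)+

lemmas depolarization_normalize =
  depolarization_left_nested depolarization_right_nested bracket_swap_nested
  minus_left minus_right bullet_ac scale_numeral_2 scale_right_distrib scale_right_diff_distrib

text \<open>Pairing x_i x_j with x_j x_i leaves 2 x3 \<bullet> [x1, x2] + [x2 \<bullet> x3, x1] -
  [x1 \<bullet> x3, x2], so one instance of the transposed Leibniz rule suffices.\<close>

lemma depolarization_satisfies_T:
  "satisfies_axiom scale (depolarization scale bullet bracket) axiom_T"
  unfolding satisfies_axiom_T_iff
proof (intro allI, goal_cases)
  case (1 x1 x2 x3)
  have leibniz: "bracket (bullet x1 x3) x2 =
      bullet x3 (bracket x1 x2) + bullet x3 (bracket x1 x2) + bracket (bullet x2 x3) x1"
    using transposed_leibniz[of x3 x1 x2] bracket_anticommute[of x1 "bullet x3 x2"]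
    by (simp add: scale_numeral_2 bullet_ac)
  \<comment> \<open>Inner brackets are oriented cyclically as [x1, x2], [x2, x3], [x3, x1]. With
    \<open>scale_scale\<close> removed, \<open>scale 2\<close> unfolds into a sum instead of merging
    with the common factor 1/4.\<close>
  show ?case
    by (simp add: depolarization_normalize leibniz
        bracket_anticommute[of x2 x1] bracket_anticommute[of x3 x2] bracket_anticommute[of x1 x3]
        del: scale_scale)
qed

text \<open>The commutator of \<mu> is the bracket, so the twelve terms group into the cyclic sum of
  double commutators.\<close>

lemma depolarization_satisfies_J:
  "satisfies_axiom scale (depolarization scale bullet bracket) axiom_J"
  unfolding satisfies_axiom_J_iff
proof (intro allI, goal_cases)
  case (1 x1 x2 x3)
  have jacobi_solved: "bracket (bracket x1 x2) x3 =
      - bracket (bracket x2 x3) x1 - bracket (bracket x3 x1) x2"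
    using jacobi[of x1 x2 x3] by (simp add: algebra_simps eq_neg_iff_add_eq_0)
  show ?case
    by (simp add: depolarization_normalize jacobi_solved
        bracket_anticommute[of x2 x1] bracket_anticommute[of x3 x2] bracket_anticommute[of x1 x3]
        del: scale_scale)
qed

text \<open>The anticommutator of \<mu> is \<bullet>, so the terms group into (x1 \<bullet> x2)
  \<bullet> x3 - (x2 \<bullet> x3) \<bullet> x1.\<close>

lemma depolarization_satisfies_A:
  "satisfies_axiom scale (depolarization scale bullet bracket) axiom_A"
  unfolding satisfies_axiom_A_iff
proof (intro allI, goal_cases)
  case (1 x1 x2 x3)
  show ?case
    by (simp add: depolarization_normalize
        bracket_anticommute[of x2 x1] bracket_anticommute[of x3 x2] bracket_anticommute[of x1 x3]
        del: scale_scale)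
qed

end

definition coeff_functional ::
  "('k::field \<times> nat magma_word) list \<Rightarrow> (nat magma_word \<Rightarrow>\<^sub>0 'k) \<Rightarrow> 'k" where
  "coeff_functional ws a = (\<Sum>(c, m)\<leftarrow>ws. c * Poly_Mapping.lookup a m)"

lemma subspace_coeff_functional_kernel: "comb.subspace {a. coeff_functional ws a = 0}"
proof -
  have "coeff_functional ws (a + b) = coeff_functional ws a + coeff_functional ws b" for a b
    unfolding coeff_functional_def
    by (induction ws) (auto simp: lookup_add algebra_simps)
  moreover have "coeff_functional ws (c *\<^sub>c a) = c * coeff_functional ws a" for c a
    unfolding coeff_functional_def
    by (induction ws) (auto simp: lookup_comb_scale algebra_simps)
  moreover have "coeff_functional ws 0 = 0"
    unfolding coeff_functional_def by (induction ws) auto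
  ultimately show ?thesis
    by (simp add: comb.subspace_def)
qed

lemma lookup_permute_axiom:
  assumes "bij \<sigma>"
  shows "Poly_Mapping.lookup (permute_axiom \<sigma> a) m =
    Poly_Mapping.lookup a (map_magma_word (inv \<sigma>) m)"
proof -
  have eq: "map_magma_word \<sigma> n = m \<longleftrightarrow> n = map_magma_word (inv \<sigma>) m" for n
    using assms
    by (auto simp: magma_word.map_comp o_def magma_word.map_ident
        bij_is_surj[THEN surj_f_inv_f] bij_is_inj[THEN inv_f_f])
  have "Poly_Mapping.lookup (permute_axiom \<sigma> a) m =
      (\<Sum>n\<in>Poly_Mapping.keys a. if n = map_magma_word (inv \<sigma>) m then Poly_Mapping.lookup a n else 0)"
    unfolding permute_axiom_def
    by (simp add: lookup_sum lookup_single when_def eq)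
  also have "\<dots> = Poly_Mapping.lookup a (map_magma_word (inv \<sigma>) m)"
    by (simp add: sum.delta in_keys_iff)
  finally show ?thesis .
qed

text \<open>A kernel containing the orbit contains its span. Here \<tau> plays the role of
  \<open>inv \<sigma>\<close>; listing its six value triples turns the orbit condition into six
  finite computations.\<close>

lemma not_deducible_from_functional:
  assumes orbit: "\<And>\<tau>. (\<tau> 1, \<tau> 2, \<tau> 3) \<in>
      {(1, 2, 3), (1, 3, 2), (2, 1, 3), (2, 3, 1), (3, 1, 2), (3, 2, 1)} \<Longrightarrow>
      (\<Sum>(c, m)\<leftarrow>ws. c * Poly_Mapping.lookup a (map_magma_word \<tau> m)) = 0"
    and nonzero: "coeff_functional ws b \<noteq> 0"
  shows "\<not> deducible_from b a"
proof
  have "coeff_functional ws (permute_axiom \<sigma> a) = 0" if \<sigma>: "\<sigma> permutes {1, 2, 3}" for \<sigma>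
  proof -
    have "{inv \<sigma> 1, inv \<sigma> 2, inv \<sigma> 3} = {1, 2, 3}"
      using permutes_image[OF permutes_inv[OF \<sigma>]] by simp
    then show ?thesis
      using orbit[of "inv \<sigma>"]
      by (simp only: set3_eq_iff coeff_functional_def lookup_permute_axiom[OF permutes_bij[OF \<sigma>]])
  qed
  then have "comb.span {permute_axiom \<sigma> a | \<sigma>. \<sigma> permutes {1, 2, 3}} \<subseteq>
      {a. coeff_functional ws a = 0}"
    by (intro comb.span_minimal subspace_coeff_functional_kernel) auto
  moreover assume "deducible_from b a"
  ultimately show False
    using nonzero by (auto simp: deducible_from_def)
qed

lemmas lookup_axiom_simps =
  coeff_functional_def lookup_add lookup_minus lookup_comb_scale lookup_single when_def

text \<open>The left-nested coefficients of \<open>axiom_J\<close> are the signs of the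
  permutations, so two monomials differing by a transposition cancel throughout the orbit. The value
  is 2 - 1 on \<open>axiom_T\<close> and 1 + 0 on \<open>axiom_A\<close>.\<close>

lemma not_deducible_from_J:
  "\<not> deducible_from (axiom_T :: nat magma_word \<Rightarrow>\<^sub>0 'k::field_char_0) axiom_J"
  "\<not> deducible_from (axiom_A :: nat magma_word \<Rightarrow>\<^sub>0 'k::field_char_0) axiom_J"
  by (rule not_deducible_from_functional[where ws = "[(1, lmonomial 1 2 3), (1, lmonomial 1 3 2)]"],
      elim insertE emptyE Pair_inject, simp_all add: axiom_T_def axiom_J_def axiom_A_def lookup_axiom_simps del: One_nat_def)+

text \<open>The coefficients of \<open>axiom_J\<close> itself give a functional which changes by the sign of the permutation.\<close>

lemma J_not_deducible:
  "\<not> deducible_from (axiom_J :: nat magma_word \<Rightarrow>\<^sub>0 'k::field_char_0) axiom_T"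
  "\<not> deducible_from (axiom_J :: nat magma_word \<Rightarrow>\<^sub>0 'k::field_char_0) axiom_A"
  by (rule not_deducible_from_functional[where ws =
        "[(1, lmonomial 1 2 3), (-1, lmonomial 2 1 3), (-1, lmonomial 3 2 1),
          (-1, lmonomial 1 3 2), (1, lmonomial 2 3 1), (1, lmonomial 3 1 2),
          (-1, rmonomial 1 2 3), (1, rmonomial 2 1 3), (1, rmonomial 3 2 1),
          (1, rmonomial 1 3 2), (-1, rmonomial 2 3 1), (-1, rmonomial 3 1 2)]"],
      elim insertE emptyE Pair_inject, simp_all add: axiom_T_def axiom_J_def axiom_A_def lookup_axiom_simps del: One_nat_def)+

text \<open>The alternating sum of left-nested coefficients kills \<open>axiom_A\<close>, whose
  left-nested part is symmetric in the two inner factors, and is 4 on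
  \<open>axiom_T\<close>.\<close>

lemma T_not_deducible_from_A:
  "\<not> deducible_from (axiom_T :: nat magma_word \<Rightarrow>\<^sub>0 'k::field_char_0) axiom_A"
  by (rule not_deducible_from_functional[where ws =
        "[(1, lmonomial 1 2 3), (-1, lmonomial 2 1 3), (-1, lmonomial 3 2 1),
          (-1, lmonomial 1 3 2), (1, lmonomial 2 3 1), (1, lmonomial 3 1 2)]"],
      elim insertE emptyE Pair_inject, simp_all add: axiom_T_def axiom_A_def lookup_axiom_simps del: One_nat_def)

text \<open>Up to a factor this functional reads off the coefficient of (x1 \<bullet> x2) \<bullet>
  x3 after splitting \<mu>. \<open>axiom_T\<close> has only terms mixing \<bullet> with the bracket;
  on \<open>axiom_A\<close> the value is 4.\<close>

lemma A_not_deducible_from_T: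
  "\<not> deducible_from (axiom_A :: nat magma_word \<Rightarrow>\<^sub>0 'k::field_char_0) axiom_T"
  by (rule not_deducible_from_functional[where ws =
        "[(1, lmonomial 1 2 3), (1, lmonomial 2 1 3), (1, rmonomial 3 1 2), (1, rmonomial 3 2 1)]"],
      elim insertE emptyE Pair_inject, simp_all add: axiom_T_def axiom_A_def lookup_axiom_simps del: One_nat_def)

theorem proposition4:
  fixes scale :: "'k::{alg_closed_field, field_char_0} \<Rightarrow> 'v::ab_group_add \<Rightarrow> 'v"
    and bullet bracket :: "'v \<Rightarrow> 'v \<Rightarrow> 'v"
  shows
    "(transposed_poisson_algebra scale bullet bracket \<longrightarrow>
        satisfies_axiom scale (depolarization scale bullet bracket) axiom_T \<and>
        satisfies_axiom scale (depolarization scale bullet bracket) axiom_J \<and>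
        satisfies_axiom scale (depolarization scale bullet bracket) axiom_A) \<and>
     (let T = axiom_T; J = axiom_J; A = axiom_A :: nat magma_word \<Rightarrow>\<^sub>0 'k in
        \<not> deducible_from T J \<and> \<not> deducible_from T A \<and>
        \<not> deducible_from J T \<and> \<not> deducible_from J A \<and>
        \<not> deducible_from A T \<and> \<not> deducible_from A J)"
  using transposed_poisson_algebra.depolarization_satisfies_T
    transposed_poisson_algebra.depolarization_satisfies_J
    transposed_poisson_algebra.depolarization_satisfies_A
    not_deducible_from_J J_not_deducible T_not_deducible_from_A A_not_deducible_from_T
  unfolding Let_def by blast

end
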